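(* For every integer $n\ge 0$, the $q$-Charlier polynomials are given by $$ C_n(x,a;q)= \sum_{B\subseteq [n]}\ \sum_{\sigma\in \mathfrak{S}_{[n]\setminus B}} q^{\mathrm{inv}(\sigma)+\mathrm{inv}(B)}\,(-1)^{n-\mathrm{cyc}(\sigma)}\,a^{|B|}\,x^{\mathrm{cyc}(\sigma)} . $$
   Context: Let $a,q$ be indeterminates and $[n]_q=\frac{1-q^n}{1-q}$. The $q$-Charlier polynomials $C_n(x,a;q)$ are the polynomials in $x$ defined by $C_{-1}(x,a;q)=0$, $C_0(x,a;q)=1$ and $$C_{n+1}(x,a;q)=(x-aq^n-[n]_q)\,C_n(x,a;q)-a[n]_q q^{n-1}C_{n-1}(x,a;q)\qquad(n\ge 0).$$ Here $[n]=\{1,2,\dots,n\}$, and $\mathfrak{S}_{[n]\setminus B}$ is the set of permutations of the set $[n]\setminus B$ (with one element, the empty permutation, if $B=[n]$). For a permutation $\sigma$, $\mathrm{cyc}(\sigma)$ is its number of cycles, and $\mathrm{inv}(\sigma)$ is defined as follows: write $\sigma$ as a product of disjoint cycles (including 1-cycles), each cycle written with its minimum first, the cycles ordered by increasing minima; remove the parentheses to obtain a word; $\mathrm{inv}(\sigma)$ is the number of inversions of this word (pairs of positions $i<j$ such that the $i$-th letter is larger than the $j$-th letter). For a subset $B\subseteq[n]$, $\mathrm{inv}(B)=\sum_{b\in B}(b-1)$. *)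

theory Defs
  imports
    "HOL-Combinatorics.Orbits"
    "HOL-Combinatorics.Cycles"
    "HOL-Computational_Algebra.Polynomial"
begin

definition q_bracket :: "'a::field \<Rightarrow> nat \<Rightarrow> 'a" where
  "q_bracket q n = (1 - q ^ n) / (1 - q)"

(* The q-Charlier polynomials, as polynomials in the variable [:0, 1:].
   The case 0 of the last summand is the convention that the polynomial of index -1 is 0. *)
fun q_charlier :: "'a::field \<Rightarrow> 'a \<Rightarrow> nat \<Rightarrow> 'a poly" where
  "q_charlier a q 0 = 1"
| "q_charlier a q (Suc n) =
     ([:0, 1:] - [:a * q ^ n:] - [:q_bracket q n:]) * q_charlier a q n
     - (case n of 0 \<Rightarrow> 0
        | Suc m \<Rightarrow> smult (a * q_bracket q n * q ^ (n - 1)) (q_charlier a q m))"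

(* A permutation of S is a function p with p permutes S, so it fixes every point outside S.
   Only the orbits of points of S are cycles of the permutation; a fixed point in S is a 1-cycle. *)
definition cycle_sets :: "nat set \<Rightarrow> (nat \<Rightarrow> nat) \<Rightarrow> nat set set" where
  "cycle_sets S p = orbit p ` S"

definition cyc :: "nat set \<Rightarrow> (nat \<Rightarrow> nat) \<Rightarrow> nat" where
  "cyc S p = card (cycle_sets S p)"

(* support p m is the cycle [m, p m, p (p m), ...] of m, written from m on. *)
definition cycle_word :: "nat set \<Rightarrow> (nat \<Rightarrow> nat) \<Rightarrow> nat list" where
  "cycle_word S p = concat (map (support p) (sorted_list_of_set (Min ` cycle_sets S p)))"

definition word_inv :: "nat list \<Rightarrow> nat" where
  "word_inv w = card {(i, j). i < j \<and> j < length w \<and> w ! i > w ! j}"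

definition perm_inv :: "nat set \<Rightarrow> (nat \<Rightarrow> nat) \<Rightarrow> nat" where
  "perm_inv S p = word_inv (cycle_word S p)"

definition set_inv :: "nat set \<Rightarrow> nat" where
  "set_inv B = (\<Sum>b\<in>B. b - 1)"

end

theory Submission
  imports Defs
begin

text \<open>
  Inserting a new maximum \<open>m\<close> into a permutation of a set of size \<open>k\<close> either appends a new last
  cycle, which creates no inversion, or puts \<open>m\<close> directly behind a letter of the cycle word, which
  creates as many inversions as there are letters further right. Hence the signed sum over the
  permutations of a \<open>k\<close>-set is the \<open>q\<close>-falling factorial, the product of the factors
  \<open>x - [i]\<^sub>q\<close> for \<open>i < k\<close>. The right-hand side becomes a weighted sum over
  subsets \<open>B\<close> depending on \<open>B\<close> only through its size and its weight. Splitting off the largest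
  element gives a first recurrence; the factor \<open>[n - |B|]\<^sub>q\<close> that arises from
  multiplication by \<open>x\<close> is absorbed by lemma \<open>subset_sum_q_bracket\<close>, the analogue of
  \<open>(n - k) (n choose k) = n (n - 1 choose k)\<close>.
\<close>

section \<open>Weighted sums over subsets\<close>

lemma q_bracket_0 [simp]: "q_bracket q 0 = 0"
  by (simp add: q_bracket_def)

text \<open>Here \<open>q \<noteq> 1\<close> matters: at \<open>q = 1\<close> division by zero makes
  every bracket 0, and the recursion fails.\<close>

lemma q_bracket_Suc: "q \<noteq> 1 \<Longrightarrow> q_bracket q (Suc n) = 1 + q * q_bracket q n"
  by (simp add: q_bracket_def field_simps)

lemma q_bracket_eq_sum: "q \<noteq> 1 \<Longrightarrow> q_bracket q n = (\<Sum>i<n. q ^ i)"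
  by (simp add: q_bracket_def sum_gp_strict)

text \<open>The subsets of size \<open>k\<close> together have weight \<open>(- a) ^ k\<close> times
  q^(k(k-1)/2) times a Gaussian binomial. Keeping the subsets themselves allows recursion on the
  largest element. Each element of \<open>B\<close> carries a sign because it is a point missing
  from the permutation.\<close>

definition subset_sum :: "'a::field \<Rightarrow> 'a \<Rightarrow> nat \<Rightarrow> (nat \<Rightarrow> 'a poly) \<Rightarrow> 'a poly" where
  "subset_sum a q n f =
     (\<Sum>B\<in>Pow {1..n}. smult ((- a) ^ card B * q ^ set_inv B) (f (card B)))"

lemma subset_sum_0 [simp]: "subset_sum a q 0 f = f 0"
  by (simp add: subset_sum_def set_inv_def)

lemma subset_sum_cong:
  assumes "\<And>k. k \<le> n \<Longrightarrow> f k = g k"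
  shows "subset_sum a q n f = subset_sum a q n g"
proof -
  have "card B \<le> n" if "B \<subseteq> {1..n}" for B
    using card_mono[OF _ that] by simp
  then show ?thesis
    unfolding subset_sum_def by (intro sum.cong) (auto simp: assms)
qed

lemma subset_sum_add:
  "subset_sum a q n (\<lambda>k. f k + g k) = subset_sum a q n f + subset_sum a q n g"
  by (simp add: subset_sum_def smult_add_right sum.distrib)

lemma smult_sum_right: "smult c (\<Sum>x\<in>A. f x) = (\<Sum>x\<in>A. smult c (f x))"
  by (induction A rule: infinite_finite_induct) (auto simp: smult_add_right)

lemma subset_sum_smult:
  "subset_sum a q n (\<lambda>k. smult c (f k)) = smult c (subset_sum a q n f)"
  by (simp add: subset_sum_def smult_sum_right mult.commute)

lemma subset_sum_mult:
  "subset_sum a q n (\<lambda>k. p * f k) = p * subset_sum a q n f"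
  by (simp add: subset_sum_def sum_distrib_left)

text \<open>Split by whether \<open>B\<close> contains \<open>Suc n\<close>; this element raises the
  size by 1 and \<open>set_inv\<close> by \<open>n\<close>.\<close>

lemma subset_sum_Suc:
  "subset_sum a q (Suc n) f =
     subset_sum a q n f - smult (a * q ^ n) (subset_sum a q n (\<lambda>k. f (Suc k)))"
proof -
  have new: "Suc n \<notin> B" "finite B" if "B \<in> Pow {1..n}" for B
    using that by (auto intro: finite_subset)
  have inj: "inj_on (insert (Suc n)) (Pow {1..n})"
    using new by (intro inj_onI) (metis insert_ident)
  have split: "Pow {1..Suc n} = Pow {1..n} \<union> insert (Suc n) ` Pow {1..n}"
    by (simp add: atLeastAtMostSuc_conv Pow_insert)
  let ?g = "\<lambda>B. smult ((- a) ^ card B * q ^ set_inv B) (f (card B))"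
  have "subset_sum a q (Suc n) f = subset_sum a q n f + sum ?g (insert (Suc n) ` Pow {1..n})"
    unfolding subset_sum_def split by (rule sum.union_disjoint) (use new in auto)
  also have "sum ?g (insert (Suc n) ` Pow {1..n}) = sum (?g \<circ> insert (Suc n)) (Pow {1..n})"
    by (rule sum.reindex[OF inj])
  also have "\<dots> = - smult (a * q ^ n) (subset_sum a q n (\<lambda>k. f (Suc k)))"
    unfolding subset_sum_def smult_sum_right sum_negf[symmetric]
    by (intro sum.cong refl)
      (use new in \<open>simp add: set_inv_def power_add mult_ac del: Pow_iff One_nat_def\<close>)
  finally show ?thesis by simp
qed

text \<open>Induction with \<open>f\<close> arbitrary, since splitting off the largest element also
  needs the hypothesis for the shifted function. At \<open>k = Suc n\<close> the bracket vanishes,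
  so the largest value of \<open>f\<close> on the left does not contribute.\<close>

lemma subset_sum_q_bracket:
  assumes "q \<noteq> 1"
  shows "subset_sum a q (Suc n) (\<lambda>k. smult (q_bracket q (Suc n - k)) (f k)) =
     smult (q_bracket q (Suc n)) (subset_sum a q n f)"
proof (induction n arbitrary: f)
  case 0
  show ?case by (simp add: subset_sum_Suc)
next
  case (Suc n)
  let ?b = "q_bracket q"
  \<comment> \<open>These are the subsets without the new largest element. Peeling 1 off the bracket
    lowers its index to the one in the induction hypothesis.\<close>
  have "subset_sum a q (Suc n) (\<lambda>k. smult (?b (Suc (Suc n) - k)) (f k)) =
      subset_sum a q (Suc n) (\<lambda>k. f k + smult q (smult (?b (Suc n - k)) (f k)))"
    by (intro subset_sum_cong) (simp add: Suc_diff_le q_bracket_Suc[OF assms] smult_add_left)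
  also have "\<dots> = subset_sum a q (Suc n) f + smult (q * ?b (Suc n)) (subset_sum a q n f)"
    by (simp only: subset_sum_add subset_sum_smult Suc.IH) simp
  finally have "subset_sum a q (Suc (Suc n)) (\<lambda>k. smult (?b (Suc (Suc n) - k)) (f k)) =
      subset_sum a q (Suc n) f + smult (q * ?b (Suc n)) (subset_sum a q n f)
      - smult (a * q ^ Suc n) (smult (?b (Suc n)) (subset_sum a q n (\<lambda>k. f (Suc k))))"
    by (simp only: subset_sum_Suc[of a q "Suc n"] diff_Suc_Suc Suc.IH)
  \<comment> \<open>The factor \<open>q * q_bracket q (Suc n)\<close> is common to the last two
    terms; what remains is the splitting of \<open>subset_sum a q (Suc n) f\<close>.\<close>
  also have "\<dots> = subset_sum a q (Suc n) f + smult (q * ?b (Suc n)) (subset_sum a q (Suc n) f)"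
    by (simp add: subset_sum_Suc[of a q n f] smult_diff_right mult_ac)
  also have "\<dots> = smult (?b (Suc (Suc n))) (subset_sum a q (Suc n) f)"
    by (simp add: q_bracket_Suc[OF assms, of "Suc n"] smult_add_left)
  finally show ?case .
qed

section \<open>q-falling factorials and the three-term recurrence\<close>

definition q_falling :: "'a::field \<Rightarrow> nat \<Rightarrow> 'a poly" where
  "q_falling q m = (\<Prod>i<m. [:- q_bracket q i, 1:])"

lemma q_falling_Suc:
  "q_falling q (Suc m) = [:0, 1:] * q_falling q m - smult (q_bracket q m) (q_falling q m)"
  by (simp add: q_falling_def mult.commute)

text \<open>The auxiliary sum \<open>U\<close> has falling factorials one factor longer than those
  in \<open>R\<close>. Splitting off the largest element and multiplying by x give two relations
  between \<open>R\<close> and \<open>U\<close>; eliminating \<open>U\<close> leaves the recurrence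
  of the q-Charlier polynomials.\<close>

lemma q_charlier_eq_subset_sum:
  assumes "q \<noteq> 1"
  shows "q_charlier a q n = subset_sum a q n (\<lambda>k. q_falling q (n - k))"
proof -
  define R where "R n = subset_sum a q n (\<lambda>k. q_falling q (n - k))" for n
  define U where "U n = subset_sum a q n (\<lambda>k. q_falling q (Suc n - k))" for n
  have R_Suc: "R (Suc n) = U n - smult (a * q ^ n) (R n)" for n
    by (simp add: R_def U_def subset_sum_Suc)
  have U: "[:0, 1:] * R n = U n +
      subset_sum a q n (\<lambda>k. smult (q_bracket q (n - k)) (q_falling q (n - k)))" for n
    unfolding R_def U_def subset_sum_mult[symmetric] subset_sum_add[symmetric]
    by (intro subset_sum_cong) (simp add: Suc_diff_le q_falling_Suc)
  \<comment> \<open>Multiplication by x leaves a bracket that depends on \<open>k\<close>;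
    \<open>subset_sum_q_bracket\<close> makes it constant and shortens the range, which produces
    \<open>U n\<close>.\<close>
  have U_Suc: "[:0, 1:] * R (Suc n) = U (Suc n) + smult (q_bracket q (Suc n)) (U n)" for n
    unfolding U subset_sum_q_bracket[OF assms] by (simp add: U_def)
  \<comment> \<open>The recurrence reaches back two indices, so consecutive values are carried
    together.\<close>
  have "q_charlier a q n = R n \<and> q_charlier a q (Suc n) = R (Suc n)"
  proof (induction n)
    case 0
    have "U 0 = [:0, 1:]" using U[of 0] by (simp add: R_def q_falling_def)
    then show ?case by (simp add: R_Suc) (simp add: R_def q_falling_def)
  next
    case (Suc n)
    have "R (Suc (Suc n)) = [:0, 1:] * R (Suc n) - smult (q_bracket q (Suc n)) (U n)
        - smult (a * q ^ Suc n) (R (Suc n))"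
      unfolding U_Suc R_Suc[of "Suc n"] by simp
    also have "U n = R (Suc n) + smult (a * q ^ n) (R n)"
      by (simp add: R_Suc)
    finally have R: "R (Suc (Suc n)) = ([:0, 1:] - [:a * q ^ Suc n:] - [:q_bracket q (Suc n):]) * R (Suc n)
        - smult (a * q_bracket q (Suc n) * q ^ n) (R n)"
      by (simp add: algebra_simps smult_add_right smult_diff_left)
    show ?case
      using Suc unfolding R by (simp only: q_charlier.simps(2)[of a q "Suc n"]) simp
  qed
  then show ?thesis by (simp add: R_def)
qed

section \<open>Inserting a maximum into the cycle word\<close>

text \<open>A local description of a cycle written as a word: appending the head closes the cycle,
  so the last letter needs no separate condition. Unlike \<open>least_power\<close>, it is easy to
  follow under insertion of a letter.\<close>

definition cycle_list :: "('a \<Rightarrow> 'a) \<Rightarrow> 'a list \<Rightarrow> bool" where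
  "cycle_list p xs \<longleftrightarrow>
     xs \<noteq> [] \<and> distinct xs \<and> successively (\<lambda>x y. y = p x) (xs @ [hd xs])"

text \<open>The letter at position \<open>i\<close> is the \<open>i\<close>-th iterate of the head.
  The closing letter shows that the length is a period, and distinctness excludes a shorter
  one.\<close>

lemma support_hd_eq:
  assumes "cycle_list p xs"
  shows "support p (hd xs) = xs"
proof -
  let ?x = "hd xs" and ?ys = "xs @ [hd xs]"
  have xs: "xs \<noteq> []" "distinct xs" and succ: "successively (\<lambda>x y. y = p x) ?ys"
    using assms by (auto simp: cycle_list_def)
  have ys: "?ys ! i = (p ^^ i) ?x" if "i \<le> length xs" for i
    using that
  proof (induction i)
    case 0
    then show ?case using xs by (simp add: nth_append hd_conv_nth)
  next
    case (Suc i)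
    then have "?ys ! Suc i = p (?ys ! i)"
      using succ unfolding successively_conv_nth by auto
    with Suc show ?case by simp
  qed
  have xs_nth: "xs ! i = (p ^^ i) ?x" if "i < length xs" for i
    using ys[of i] that by (simp add: nth_append)
  have "least_power p ?x = length xs"
    unfolding least_power_def
  proof (rule Least_equality)
    show "(p ^^ length xs) ?x = ?x \<and> length xs > 0"
      using ys[of "length xs"] xs by simp
  next
    fix k assume k: "(p ^^ k) ?x = ?x \<and> k > 0"
    show "length xs \<le> k"
    proof (rule ccontr)
      assume "\<not> length xs \<le> k"
      then have "xs ! k = xs ! 0"
        using k xs xs_nth[of k] xs_nth[of 0] by simp
      with \<open>\<not> length xs \<le> k\<close> k xs show False
        by (simp add: nth_eq_iff_index_eq)
    qed
  qed
  then show ?thesis by (intro nth_equalityI) (simp_all add: xs_nth)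
qed

lemma hd_support:
  assumes "permutation p"
  shows "hd (support p x) = x"
  using least_power_of_permutation(2)[OF assms, of x] by (simp add: hd_map)

lemma cycle_list_support:
  assumes "permutation p"
  shows "cycle_list p (support p x)"
proof -
  let ?n = "least_power p x"
  have n: "(p ^^ ?n) x = x" "?n > 0"
    using least_power_of_permutation[OF assms] by auto
  have "support p x @ [hd (support p x)] = map (\<lambda>i. (p ^^ i) x) [0..<Suc ?n]"
    using n hd_support[OF assms, of x] by simp
  then have "successively (\<lambda>x y. y = p x) (support p x @ [hd (support p x)])"
    by (simp only: successively_map) (simp add: successively_conv_nth del: upt_Suc)
  then show ?thesis
    using n cycle_of_permutation[OF assms] by (simp add: cycle_list_def)
qed

lemma set_support:
  assumes "permutation p"
  shows "set (support p x) = orbit p x"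
  using orbit_altdef_bounded[OF least_power_of_permutation[OF assms]] by auto

section \<open>Inserting a letter into a cycle\<close>

definition insert_after :: "'a \<Rightarrow> 'a \<Rightarrow> 'a list \<Rightarrow> 'a list" where
  "insert_after c m xs = concat (map (\<lambda>x. if x = c then [x, m] else [x]) xs)"

lemma insert_after_simps [simp]:
  "insert_after c m [] = []"
  "insert_after c m (x # xs) = (if x = c then [x, m] else [x]) @ insert_after c m xs"
  "insert_after c m (xs @ ys) = insert_after c m xs @ insert_after c m ys"
  by (simp_all add: insert_after_def)

text \<open>Insertion acts letter by letter, so it may be carried out in each cycle
  separately.\<close>

lemma insert_after_concat:
  "insert_after c m (concat xss) = concat (map (insert_after c m) xss)"
  by (induction xss) auto

lemma insert_after_id: "c \<notin> set xs \<Longrightarrow> insert_after c m xs = xs"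
  by (induction xs) auto

lemma set_insert_after:
  "set (insert_after c m xs) = (if c \<in> set xs then insert m (set xs) else set xs)"
  by (induction xs) auto

lemma distinct_insert_after:
  "distinct xs \<Longrightarrow> m \<notin> set xs \<Longrightarrow> distinct (insert_after c m xs)"
  by (induction xs) (auto simp: set_insert_after insert_after_id)

text \<open>The final letter \<open>z\<close> is never an argument of the map, so nothing is
  required of it.\<close>

lemma successively_graph_cong:
  assumes "\<And>x. x \<in> set xs \<Longrightarrow> f x = g x"
  shows "successively (\<lambda>x y. y = f x) (xs @ [z]) = successively (\<lambda>x y. y = g x) (xs @ [z])"
  using assms by (induction xs) (auto simp: successively_Cons)

text \<open>As \<open>p\<close> fixes \<open>m\<close>, the new map sends \<open>c\<close> to
  \<open>m\<close> and \<open>m\<close> to \<open>p c\<close>, and agrees with \<open>p\<close>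
  elsewhere: the step from \<open>c\<close> to \<open>p c\<close> is subdivided by
  \<open>m\<close>.\<close>

lemma cycle_list_insert_after:
  assumes xs: "cycle_list p xs" and "m \<notin> set xs" "c \<noteq> m" "p m = m"
  shows "cycle_list (p \<circ> transpose m c) (insert_after c m xs)"
    and "hd (insert_after c m xs) = hd xs"
proof -
  let ?p = "p \<circ> transpose m c"
  have p': "?p x = p x" if "x \<noteq> c" "x \<noteq> m" for x
    using that by simp
  have "cycle_list ?p (insert_after c m xs) \<and> hd (insert_after c m xs) = hd xs"
  proof (cases "c \<in> set xs")
    case False
    have "successively (\<lambda>x y. y = ?p x) (xs @ [hd xs])"
      using xs False assms(2) unfolding cycle_list_def
      by (subst successively_graph_cong[where g = p]) (auto intro!: p' simp del: o_apply)
    then show ?thesis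
      using xs False by (simp add: cycle_list_def insert_after_id)
  next
    case True
    then obtain us vs where eq: "xs = us @ c # vs"
      by (meson split_list)
    then have c: "c \<notin> set us" "c \<notin> set vs" and d: "distinct xs"
      using xs by (auto simp: cycle_list_def)
    let ?h = "hd xs"
    \<comment> \<open>Keeping the closing head behind \<open>vs\<close> also covers the case that
      \<open>c\<close> is the last letter, whose successor is the head.\<close>
    have succ: "successively (\<lambda>x y. y = p x) (us @ c # (vs @ [?h]))"
      using xs by (simp add: cycle_list_def eq)
    then have us: "successively (\<lambda>x y. y = p x) (us @ [c])"
      and vs: "successively (\<lambda>x y. y = p x) (vs @ [?h])" and "hd (vs @ [?h]) = p c"
      by (simp_all add: successively_append_iff successively_Cons)
    have "?p x = p x" if "x \<in> set us \<union> set vs" for x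
      using that c assms(2) eq by (intro p') auto
    then have "successively (\<lambda>x y. y = ?p x) (us @ [c])"
      "successively (\<lambda>x y. y = ?p x) (vs @ [?h])"
      using us vs by (subst successively_graph_cong[where g = p]; simp del: o_apply)+
    then have "successively (\<lambda>x y. y = ?p x) (us @ c # m # (vs @ [?h]))"
      using \<open>hd (vs @ [?h]) = p c\<close> assms(3,4)
      by (simp add: successively_append_iff successively_Cons)
    moreover have "hd (us @ c # m # vs) = ?h"
      by (simp add: eq hd_append)
    ultimately show ?thesis
      using d assms(2,3) by (simp add: cycle_list_def insert_after_id c eq)
  qed
  then show "cycle_list ?p (insert_after c m xs)" "hd (insert_after c m xs) = hd xs"
    by auto
qed

lemma support_comp_transpose:
  assumes p: "p permutes S" and "finite S" "m \<notin> S" "c \<in> S" "t \<in> S"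
  shows "support (p \<circ> transpose m c) t = insert_after c m (support p t)"
proof -
  have perm: "permutation p"
    using p \<open>finite S\<close> permutation_permutes by blast
  have "set (support p t) \<subseteq> S"
    using permutes_in_funpow_image[OF p \<open>t \<in> S\<close>] by auto
  then have m: "m \<notin> set (support p t)" "c \<noteq> m" "p m = m"
    using assms by (auto simp: permutes_not_in)
  note * = cycle_list_insert_after[OF cycle_list_support[OF perm, of t] m]
  show ?thesis
    using support_hd_eq[OF *(1)] unfolding *(2) hd_support[OF perm] .
qed

section \<open>Inversions of words\<close>

lemma word_inv_Nil [simp]: "word_inv [] = 0"
  by (simp add: word_inv_def)

lemma word_inv_Cons:
  "word_inv (x # xs) = length (filter (\<lambda>y. y < x) xs) + word_inv xs"
proof -
  let ?I = "{(i, j). i < j \<and> j < length xs \<and> xs ! i > xs ! j}"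
  let ?J = "{j. j < length xs \<and> xs ! j < x}"
  have "finite ?I"
    by (rule finite_subset[of _ "{..<length xs} \<times> {..<length xs}"]) auto
  have eq: "{(i, j). i < j \<and> j < length (x # xs) \<and> (x # xs) ! i > (x # xs) ! j} =
      (\<lambda>j. (0, Suc j)) ` ?J \<union> (\<lambda>(i, j). (Suc i, Suc j)) ` ?I" (is "?K = _")
  proof (rule set_eqI, clarify)
    fix i j
    show "(i, j) \<in> ?K \<longleftrightarrow>
      (i, j) \<in> (\<lambda>j. (0, Suc j)) ` ?J \<union> (\<lambda>(i, j). (Suc i, Suc j)) ` ?I"
      by (cases i; cases j) auto
  qed
  have "word_inv (x # xs) = card ((\<lambda>j. (0::nat, Suc j)) ` ?J) +
      card ((\<lambda>(i, j). (Suc i, Suc j)) ` ?I)"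
    unfolding word_inv_def eq using \<open>finite ?I\<close> by (intro card_Un_disjoint) auto
  also have "\<dots> = card ?J + card ?I"
    by (intro arg_cong2[of _ _ _ _ "(+)"] card_image) (auto simp: inj_on_def)
  finally show ?thesis
    by (simp add: length_filter_conv_card word_inv_def)
qed

lemma word_inv_insert_max:
  assumes "\<forall>x\<in>set (us @ vs). x < m"
  shows "word_inv (us @ m # vs) = word_inv (us @ vs) + length vs"
  using assms
  by (induction us) (auto simp: word_inv_Cons)

section \<open>Cycles and cycle words after adding a point\<close>

lemma orbit_comp_transpose:
  assumes "p permutes S" "finite S" "m \<notin> S" "c \<in> S" "t \<in> S"
  shows "orbit (p \<circ> transpose m c) t =
    (if c \<in> orbit p t then insert m (orbit p t) else orbit p t)"
proof -
  have "p \<circ> transpose m c permutes insert m S"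
    using assms by (intro permutes_compose permutes_swap_id permutes_imp_permutes_insert) auto
  then have "permutation p" "permutation (p \<circ> transpose m c)"
    using assms permutes_imp_permutation[of "insert m S"] permutes_imp_permutation[of S] by auto
  then show ?thesis
    using arg_cong[OF support_comp_transpose[OF assms], of set]
    by (simp only: set_support set_insert_after)
qed

text \<open>The new point is the image of \<open>c\<close>, so it joins the orbit of
  \<open>c\<close> and opens no orbit of its own.\<close>

lemma cycle_sets_comp_transpose:
  assumes p: "p permutes S" "finite S" "m \<notin> S" "c \<in> S"
  shows "cycle_sets (insert m S) (p \<circ> transpose m c) =
    (\<lambda>A. if c \<in> A then insert m A else A) ` cycle_sets S p"
proof -
  let ?p = "p \<circ> transpose m c"
  have "?p permutes insert m S"
    using assms by (intro permutes_compose permutes_swap_id permutes_imp_permutes_insert) auto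
  then have "permutation ?p"
    using assms(2) by (intro permutes_imp_permutation[of "insert m S"]) auto
  then have "orbit ?p (?p c) = orbit ?p c"
    by (rule permutation_orbit_step)
  moreover have "?p c = m"
    using p by (simp add: permutes_not_in)
  ultimately have "orbit ?p m = orbit ?p c"
    by (simp only:)
  then have "cycle_sets (insert m S) ?p = orbit ?p ` S"
    using \<open>c \<in> S\<close> by (auto simp: cycle_sets_def)
  then show ?thesis
    by (auto simp: cycle_sets_def orbit_comp_transpose[OF assms] image_image)
qed

lemma cycle_setsD:
  assumes "p permutes S" "A \<in> cycle_sets S p"
  shows "A \<subseteq> S" "A \<noteq> {}"
  using assms by (auto simp: cycle_sets_def orbit_nonempty dest: permutes_orbit_subset)

lemma Min_cycle_sets_subset:
  assumes "p permutes S" "finite S"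
  shows "Min ` cycle_sets S p \<subseteq> S"
proof clarify
  fix A assume "A \<in> cycle_sets S p"
  then have A: "A \<subseteq> S" "A \<noteq> {}"
    using cycle_setsD[OF assms(1)] by auto
  then have "Min A \<in> A"
    using assms(2) by (intro Min_in) (rule finite_subset)
  with A show "Min A \<in> S" by blast
qed

lemma cyc_comp_transpose:
  assumes p: "p permutes S" "finite S" "m \<notin> S" "c \<in> S"
  shows "cyc (insert m S) (p \<circ> transpose m c) = cyc S p"
  unfolding cyc_def cycle_sets_comp_transpose[OF assms]
proof (rule card_image, rule inj_onI)
  fix A B assume "A \<in> cycle_sets S p" "B \<in> cycle_sets S p"
  then have "m \<notin> A" "m \<notin> B"
    using cycle_setsD(1)[OF p(1)] \<open>m \<notin> S\<close> by blast+
  then show "(if c \<in> A then insert m A else A) = (if c \<in> B then insert m B else B) \<Longrightarrow> A = B"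
    by (auto split: if_splits)
qed

text \<open>A new maximum changes no minimum of a cycle, so the order of the cycles and their first
  letters stay the same.\<close>

lemma cycle_word_comp_transpose:
  assumes p: "p permutes S" "finite S" "\<forall>x\<in>S. x < m" "c \<in> S"
  shows "cycle_word (insert m S) (p \<circ> transpose m c) = insert_after c m (cycle_word S p)"
proof -
  have "m \<notin> S" using p by auto
  have "Min (insert m A) = Min A" if "A \<in> cycle_sets S p" for A
  proof -
    have A: "A \<subseteq> S" "A \<noteq> {}"
      using cycle_setsD[OF p(1) that] by auto
    then have "finite A"
      using p(2) finite_subset by blast
    moreover have "Min A < m"
      using Min_in[OF \<open>finite A\<close> A(2)] A(1) p(3) by blast
    ultimately show ?thesis using A(2) by simp
  qed
  then have "Min ` cycle_sets (insert m S) (p \<circ> transpose m c) = Min ` cycle_sets S p"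
    unfolding cycle_sets_comp_transpose[OF p(1,2) \<open>m \<notin> S\<close> p(4)] image_image
    by (intro image_cong) auto
  moreover have "finite (Min ` cycle_sets S p)"
    using p(2) by (simp add: cycle_sets_def)
  moreover have "support (p \<circ> transpose m c) t = insert_after c m (support p t)"
    if "t \<in> Min ` cycle_sets S p" for t
    using that Min_cycle_sets_subset[OF p(1,2)] support_comp_transpose[OF p(1,2) \<open>m \<notin> S\<close> p(4)]
    by blast
  ultimately show ?thesis
    unfolding cycle_word_def insert_after_concat map_map
    by (intro arg_cong[of _ _ concat] map_cong) (simp_all only: set_sorted_list_of_set o_apply)
qed

lemma cycle_sets_insert_fixed:
  assumes "p permutes S" "m \<notin> S"
  shows "cycle_sets (insert m S) p = insert {m} (cycle_sets S p)"
proof -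
  have "orbit p m = {m}"
    by (simp add: orbit_eq_singleton_iff permutes_not_in[OF assms])
  then show ?thesis by (simp add: cycle_sets_def)
qed

lemma cyc_insert_fixed:
  assumes "p permutes S" "finite S" "m \<notin> S"
  shows "cyc (insert m S) p = Suc (cyc S p)"
proof -
  have "{m} \<notin> cycle_sets S p"
    using cycle_setsD(1)[OF assms(1)] assms(3) by blast
  moreover have "finite (cycle_sets S p)"
    using assms(2) by (simp add: cycle_sets_def)
  ultimately show ?thesis
    by (simp add: cyc_def cycle_sets_insert_fixed[OF assms(1,3)])
qed

text \<open>The 1-cycle of \<open>m\<close> has the largest minimum and therefore comes
  last.\<close>

lemma cycle_word_insert_fixed:
  assumes p: "p permutes S" "finite S" and less: "\<forall>x\<in>S. x < m"
  shows "cycle_word (insert m S) p = cycle_word S p @ [m]"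
proof -
  let ?M = "Min ` cycle_sets S p"
  have m: "m \<notin> S" using less by auto
  have M: "?M \<subseteq> S" "finite ?M"
    using Min_cycle_sets_subset[OF p] p(2) by (auto simp: cycle_sets_def)
  have "sorted_list_of_set (insert m ?M) = insort m (sorted_list_of_set ?M)"
    using M m by (intro sorted_list_of_set_insert) auto
  also have "\<dots> = sorted_list_of_set ?M @ [m]"
    using M less by (intro sorted_insort_is_snoc) (auto intro: less_imp_le)
  finally have "sorted_list_of_set (Min ` cycle_sets (insert m S) p) = sorted_list_of_set ?M @ [m]"
    by (simp add: cycle_sets_insert_fixed[OF p(1) m])
  moreover have "support p m = [m]"
    using support_hd_eq[of p "[m]"] permutes_not_in[OF p(1) m] by (simp add: cycle_list_def)
  ultimately show ?thesis
    by (simp add: cycle_word_def)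
qed

section \<open>Splitting off a point, and the signed sum over permutations\<close>

lemma permutes_insert_cases:
  assumes "p permutes insert m S"
  obtains "p permutes S" | c r where "c \<in> S" "r permutes S" "p = r \<circ> transpose m c"
proof -
  have inv: "inv p permutes insert m S"
    using assms by (rule permutes_inv)
  \<comment> \<open>The predecessor of \<open>m\<close>; composing with the transposition bypasses
    \<open>m\<close> and makes it a fixed point.\<close>
  define c where "c = inv p m"
  define r where "r = p \<circ> transpose m c"
  have "c \<in> insert m S"
    using permutes_in_image[OF inv] by (simp add: c_def)
  have "r m = m"
    by (simp add: r_def c_def permutes_inverses[OF assms])
  moreover have "r permutes insert m S"
    unfolding r_def using assms \<open>c \<in> insert m S\<close>
    by (intro permutes_compose permutes_swap_id) auto
  ultimately have r: "r permutes S"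
    using permutes_superset[of r "insert m S" S] by auto
  have p: "p = r \<circ> transpose m c"
    by (simp add: r_def comp_assoc)
  show thesis
  proof (cases "c = m")
    case True
    then show thesis using that(1) r p by simp
  next
    case False
    then show thesis using that(2)[OF _ r p] \<open>c \<in> insert m S\<close> by simp
  qed
qed

text \<open>Consequently the positions of the cycle word index the points of \<open>S\<close>, each
  exactly once.\<close>

lemma cycle_word_props:
  assumes "finite S" "p permutes S"
  shows "distinct (cycle_word S p)" "set (cycle_word S p) = S"
proof -
  have "distinct (cycle_word S p) \<and> set (cycle_word S p) = S"
    using assms
  proof (induction S arbitrary: p rule: finite_linorder_max_induct)
    case empty
    then show ?case by (simp add: cycle_word_def cycle_sets_def)
  next
    case (insert m S)
    have m: "m \<notin> S" using insert.hyps by auto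
    from insert.prems show ?case
    proof (cases rule: permutes_insert_cases)
      case 1
      with insert m show ?thesis by (simp add: cycle_word_insert_fixed)
    next
      case (2 c r)
      have "distinct (cycle_word S r)" "set (cycle_word S r) = S"
        using insert.IH[OF 2(2)] by auto
      moreover have "cycle_word (insert m S) p = insert_after c m (cycle_word S r)"
        unfolding 2(3) using insert.hyps 2 by (intro cycle_word_comp_transpose) auto
      ultimately show ?thesis
        using m 2(1) by (simp add: distinct_insert_after set_insert_after)
    qed
  qed
  then show "distinct (cycle_word S p)" "set (cycle_word S p) = S" by auto
qed

lemma word_inv_insert_after_max:
  assumes "distinct w" "\<forall>x\<in>set w. x < m" "i < length w"
  shows "word_inv (insert_after (w ! i) m w) = word_inv w + (length w - Suc i)"
proof -
  obtain us c vs where w: "w = us @ c # vs" and i: "i = length us"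
    using id_take_nth_drop[OF assms(3)] assms(3)
    by (intro that[of "take i w" "w ! i" "drop (Suc i) w"]) simp_all
  have "insert_after c m w = (us @ [c]) @ m # vs"
    using assms(1) by (simp add: w insert_after_id)
  moreover have "word_inv ((us @ [c]) @ m # vs) = word_inv ((us @ [c]) @ vs) + length vs"
    using assms(2) by (intro word_inv_insert_max) (simp add: w)
  ultimately show ?thesis
    by (simp add: w i)
qed

text \<open>Composing with the transposition on the right makes the new point \<open>m\<close> the successor
  of \<open>c\<close> in its cycle; the library's \<open>sum_over_permutations_insert\<close> composes on the left.\<close>

lemma sum_permutes_insert:
  assumes "finite S" "m \<notin> S"
  shows "sum f {p. p permutes insert m S} =
    (\<Sum>p | p permutes S. f p + (\<Sum>c\<in>S. f (p \<circ> transpose m c)))"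
proof -
  have "(\<Sum>b\<in>S. f (transpose m b \<circ> p)) = (\<Sum>c\<in>S. f (p \<circ> transpose m c))"
    if p: "p permutes S" for p
  proof -
    \<comment> \<open>Conjugation by \<open>p\<close>, which fixes \<open>m\<close>, moves
      \<open>c\<close> to \<open>p c\<close>; the two sums then differ only by reindexing along
      \<open>p\<close>.\<close>
    have "transpose m (p c) \<circ> p = p \<circ> transpose m c" for c
      by (simp add: transpose_comp_eq[OF permutes_bij[OF p]] permutes_inverses[OF p]
          permutes_not_in[OF permutes_inv[OF p] assms(2)])
    then show ?thesis
      by (subst sum.permute[OF p]) simp
  qed
  moreover have "sum f {p. p permutes insert m S} = (\<Sum>p | p permutes S. f p) +
      (\<Sum>p | p permutes S. \<Sum>b\<in>S. f (transpose m b \<circ> p))"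
    by (subst sum.swap) (simp add: sum_over_permutations_insert[OF assms] assms)
  ultimately show ?thesis
    by (simp add: sum.distrib)
qed

text \<open>Each permutation of \<open>S\<close> extends in two ways: \<open>m\<close> as a fixed
  point gives the factor x, and the insertions behind the letters give minus the bracket of
  \<open>card S\<close>. The minus sign arises because the size grows while the number of cycles
  does not.\<close>

lemma sum_permutes_eq_q_falling:
  assumes q: "q \<noteq> 1" and "finite S"
  shows "(\<Sum>p | p permutes S. monom (q ^ perm_inv S p * (-1) ^ (card S - cyc S p)) (cyc S p)) =
    q_falling q (card S)"
  using \<open>finite S\<close>
proof (induction S rule: finite_linorder_max_induct)
  case empty
  have "{p::nat \<Rightarrow> nat. p permutes {}} = {id}"
    by auto
  then show ?case
    by (simp add: perm_inv_def cycle_word_def cyc_def cycle_sets_def q_falling_def monom_0)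
next
  case (insert m S)
  let ?W = "\<lambda>S p. monom (q ^ perm_inv S p * (-1) ^ (card S - cyc S p)) (cyc S p)"
  have m: "m \<notin> S" using insert.hyps by auto
  have step: "?W (insert m S) p + (\<Sum>c\<in>S. ?W (insert m S) (p \<circ> transpose m c)) =
      [:0, 1:] * ?W S p - smult (q_bracket q (card S)) (?W S p)"
    if p: "p permutes S" for p
  proof -
    let ?w = "cycle_word S p"
    have w: "distinct ?w" "set ?w = S"
      using cycle_word_props[OF insert.hyps(1) p] by auto
    then have len: "length ?w = card S"
      by (metis distinct_card)
    \<comment> \<open>This keeps the truncated subtraction in the exponent of the sign exact, so
      that one more point flips the sign.\<close>
    have le: "cyc S p \<le> card S"
      unfolding cyc_def cycle_sets_def using insert.hyps(1) by (rule card_image_le)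
    have "perm_inv (insert m S) p = perm_inv S p"
      using word_inv_insert_max[of ?w "[]" m] insert.hyps p w
      by (simp add: perm_inv_def cycle_word_insert_fixed)
    then have "?W (insert m S) p = [:0, 1:] * ?W S p"
      using insert.hyps m p by (simp add: cyc_insert_fixed monom_Suc)
    moreover have "(\<Sum>c\<in>S. ?W (insert m S) (p \<circ> transpose m c)) =
        - smult (q_bracket q (card S)) (?W S p)"
    proof -
      \<comment> \<open>Summing over positions instead of letters, because the number of new
        inversions depends on the position; the exponents run through all numbers below
        \<open>card S\<close>.\<close>
      have "(\<Sum>c\<in>S. ?W (insert m S) (p \<circ> transpose m c)) =
          (\<Sum>i<card S. ?W (insert m S) (p \<circ> transpose m (?w ! i)))"
        using bij_betw_nth[OF w(1) refl refl]
        by (subst sum.reindex_bij_betw[symmetric, of "(!) ?w" "{..<card S}"]) (auto simp: w len)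
      also have "\<dots> = (\<Sum>i<card S. smult (- (q ^ (card S - Suc i))) (?W S p))"
      proof (rule sum.cong[OF refl])
        fix i assume "i \<in> {..<card S}"
        then have i: "i < length ?w" "?w ! i \<in> S"
          using nth_mem w len by auto
        have "perm_inv (insert m S) (p \<circ> transpose m (?w ! i)) = perm_inv S p + (card S - Suc i)"
          using word_inv_insert_after_max[OF w(1) _ i(1), of m] insert.hyps w i p len
          by (simp add: perm_inv_def cycle_word_comp_transpose)
        then show "?W (insert m S) (p \<circ> transpose m (?w ! i)) =
            smult (- (q ^ (card S - Suc i))) (?W S p)"
          using insert.hyps m p i le
          by (simp add: cyc_comp_transpose smult_monom Suc_diff_le power_add mult_ac)
      qed
      also have "\<dots> = smult (\<Sum>i<card S. - (q ^ (card S - Suc i))) (?W S p)"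
        by (rule smult_sum[symmetric])
      also have "(\<Sum>i<card S. - (q ^ (card S - Suc i))) = - q_bracket q (card S)"
        by (simp add: sum_negf sum.nat_diff_reindex q_bracket_eq_sum[OF q])
      finally show ?thesis by (simp only: smult_minus_left)
    qed
    ultimately show ?thesis by (simp only: add_uminus_conv_diff)
  qed
  have "(\<Sum>p | p permutes insert m S. ?W (insert m S) p) =
      (\<Sum>p | p permutes S. [:0, 1:] * ?W S p - smult (q_bracket q (card S)) (?W S p))"
    unfolding sum_permutes_insert[OF insert.hyps(1) m] by (intro sum.cong refl step) simp
  also have "\<dots> = q_falling q (card (insert m S))"
    using insert.hyps m
    by (simp only: sum_subtractf sum_distrib_left[symmetric] smult_sum_right[symmetric] insert.IH)
      (simp add: q_falling_Suc)
  finally show ?case .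
qed

section \<open>Combining the subset sum with the permutation sums\<close>

theorem theorem1:
  fixes a q :: "'a::field" and n :: nat
  assumes "q \<noteq> 1"
  shows "q_charlier a q n =
    (\<Sum>B\<in>Pow {1..n}. \<Sum>\<sigma>\<in>{\<sigma>. \<sigma> permutes ({1..n} - B)}.
       monom (q ^ (perm_inv ({1..n} - B) \<sigma> + set_inv B)
              * (-1) ^ (n - cyc ({1..n} - B) \<sigma>)
              * a ^ card B)
             (cyc ({1..n} - B) \<sigma>))"
  unfolding q_charlier_eq_subset_sum[OF assms] subset_sum_def
proof (rule sum.cong[OF refl])
  fix B assume B: "B \<in> Pow {1..n}"
  let ?S = "{1..n} - B"
  have "finite B" using B by (auto intro: finite_subset)
  have card: "card ?S = n - card B" "card B \<le> n"
    using B card_Diff_subset[of B "{1..n}"] card_mono[of "{1..n}" B] \<open>finite B\<close> by auto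
  have "smult ((- a) ^ card B * q ^ set_inv B)
      (monom (q ^ perm_inv ?S \<sigma> * (-1) ^ (card ?S - cyc ?S \<sigma>)) (cyc ?S \<sigma>)) =
    monom (q ^ (perm_inv ?S \<sigma> + set_inv B) * (-1) ^ (n - cyc ?S \<sigma>) * a ^ card B) (cyc ?S \<sigma>)" for \<sigma>
  proof -
    have "cyc ?S \<sigma> \<le> card ?S"
      unfolding cyc_def cycle_sets_def by (rule card_image_le) simp
    \<comment> \<open>The sign splits into one factor per element of \<open>B\<close>, absorbed by
      \<open>- a\<close>, and the sign of the permutation sum on the complement.\<close>
    then have "n - cyc ?S \<sigma> = card B + (card ?S - cyc ?S \<sigma>)"
      using card by simp
    then show ?thesis
      by (simp add: smult_monom power_add power_minus[of a] mult_ac)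
  qed
  then show "smult ((- a) ^ card B * q ^ set_inv B) (q_falling q (n - card B)) =
    (\<Sum>\<sigma> | \<sigma> permutes ?S.
       monom (q ^ (perm_inv ?S \<sigma> + set_inv B) * (-1) ^ (n - cyc ?S \<sigma>) * a ^ card B) (cyc ?S \<sigma>))"
    unfolding card(1)[symmetric] by (subst sum_permutes_eq_q_falling[OF assms, symmetric])
      (simp_all add: smult_sum_right)
qed

end
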